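(* Let $X$ and $Y$ be bounded distributive lattices and let $n\geqslant 1$ be an integer. A function $f\colon X^n\to Y$ is a quasi-polynomial function if and only if it is quasi-median decomposable.
   Context: $X$ and $Y$ are arbitrary, possibly different, bounded distributive lattices, with operations $\wedge,\vee$ and least and greatest elements denoted $0$ and $1$ (in either lattice). Write $[n]=\{1,\ldots,n\}$ and $\mathrm{med}(a,b,c)=(a\wedge b)\vee(b\wedge c)\vee(c\wedge a)$. A (lattice) polynomial function $p\colon Y^n\to Y$ is any map which can be obtained as a composition of the lattice operations $\wedge$ and $\vee$, the projections $\mathbf{y}\mapsto y_i$ ($i\in[n]$), and the constant functions $\mathbf{y}\mapsto c$ ($c\in Y$). A function $f\colon X^n\to Y$ is a quasi-polynomial function if there exist a polynomial function $p\colon Y^n\to Y$ and a unary function $\varphi\colon X\to Y$ satisfying $\varphi(x)=\mathrm{med}(\varphi(0),\varphi(x),\varphi(1))$ for every $x\in X$, such that $f(x_1,\ldots,x_n)=p(\varphi(x_1),\ldots,\varphi(x_n))$ for all $x_1,\ldots,x_n\in X$. ($\varphi$ is not required to be order-preserving.) The diagonal section of $f$ is $\delta_f\colon X\to Y$, $\delta_f(x)=f(x,\ldots,x)$. For $\mathbf{x}\in X^n$, $k\in[n]$ and $c\in X$, $\mathbf{x}_k^c$ denotes the $n$-tuple obtained from $\mathbf{x}$ by replacing its $k$th component by $c$. $f\colon X^n\to Y$ is quasi-median decomposable if, for every $\mathbf{x}\in X^n$ and every $k\in[n]$, $f(\mathbf{x})=\mathrm{med}\big(f(\mathbf{x}_k^0),\delta_f(x_k),f(\mathbf{x}_k^1)\big)$.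 *)

theory Defs
  imports Main
begin

text \<open>
  The index set \<open>[n]\<close> is represented by a type \<open>'n\<close> of class \<open>finite\<close> and \<open>n\<close>-tuples by
  functions \<open>'n \<Rightarrow> 'a\<close>; as HOL types are non-empty, \<open>n \<ge> 1\<close> holds automatically.
  The bounds \<open>0\<close> and \<open>1\<close> of a lattice are \<open>bot\<close> and \<open>top\<close>, which may coincide.
\<close>

definition med :: "'a::lattice \<Rightarrow> 'a \<Rightarrow> 'a \<Rightarrow> 'a" where
  "med a b c = sup (sup (inf a b) (inf b c)) (inf c a)"

inductive lattice_polynomial :: "(('n \<Rightarrow> 'a::lattice) \<Rightarrow> 'a) \<Rightarrow> bool" where
  proj: "lattice_polynomial (\<lambda>y. y i)"
| const: "lattice_polynomial (\<lambda>y. c)"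
| inf: "lattice_polynomial p \<Longrightarrow> lattice_polynomial q \<Longrightarrow> lattice_polynomial (\<lambda>y. inf (p y) (q y))"
| sup: "lattice_polynomial p \<Longrightarrow> lattice_polynomial q \<Longrightarrow> lattice_polynomial (\<lambda>y. sup (p y) (q y))"

definition quasi_polynomial ::
  "(('n \<Rightarrow> 'x::bounded_lattice) \<Rightarrow> 'y::lattice) \<Rightarrow> bool" where
  "quasi_polynomial f \<longleftrightarrow>
     (\<exists>(p :: ('n \<Rightarrow> 'y) \<Rightarrow> 'y) (\<phi> :: 'x \<Rightarrow> 'y).
        lattice_polynomial p \<and>
        (\<forall>x. \<phi> x = med (\<phi> bot) (\<phi> x) (\<phi> top)) \<and>
        (\<forall>x. f x = p (\<lambda>i. \<phi> (x i))))"

definition diagonal_section :: "(('n \<Rightarrow> 'x) \<Rightarrow> 'y) \<Rightarrow> 'x \<Rightarrow> 'y" where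
  "diagonal_section f x = f (\<lambda>_. x)"

definition quasi_median_decomposable ::
  "(('n \<Rightarrow> 'x::bounded_lattice) \<Rightarrow> 'y::lattice) \<Rightarrow> bool" where
  "quasi_median_decomposable f \<longleftrightarrow>
     (\<forall>x k. f x = med (f (x(k := bot))) (diagonal_section f (x k)) (f (x(k := top))))"

end

theory Submission imports Defs begin

text \<open>
  Both directions rest on the fact that in a distributive lattice \<open>med\<close> is a truncation:
  \<open>med a t b\<close> forces \<open>t\<close> between \<open>inf a b\<close> and \<open>sup a b\<close> (\<open>med_eq_truncation\<close>).

  If \<open>f\<close> is quasi-polynomial, given by \<open>p\<close> and \<open>\<phi>\<close>, fix all components except the \<open>k\<close>th. As a function
  of that component, \<open>p\<close> has the form \<open>q s = sup c (inf s d)\<close> with \<open>c \<le> d\<close>, and on the diagonal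
  it has the form \<open>sup e (inf s g)\<close> with \<open>e \<le> c\<close> and \<open>d \<le> g\<close>; both are instances of
  \<open>lattice_polynomial_on_line\<close>. Put \<open>a = \<phi> bot\<close>, \<open>b = \<phi> top\<close> and \<open>t = \<phi> (x k)\<close>. Since \<open>q a\<close> and \<open>q b\<close>
  lie in the interval from \<open>c\<close> to \<open>d\<close>, truncating a value by them is not affected by
  truncating it first to that interval. The latter turns the diagonal value at \<open>t\<close> into \<open>q t\<close>,
  which is left alone by the truncation because \<open>q\<close> preserves \<open>inf\<close> and \<open>sup\<close> and \<open>t\<close> lies between
  \<open>inf a b\<close> and \<open>sup a b\<close>.

  Conversely, if \<open>f\<close> is quasi-median decomposable, take \<open>\<phi>\<close> to be the diagonal section. Applying the
  decomposition to one component after the other expresses \<open>f x\<close> by a polynomial in the values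
  \<open>\<phi> (x i)\<close> whose constants are values of \<open>f\<close> at tuples of bounds. It remains that \<open>\<phi>\<close> takes its
  values between \<open>inf (\<phi> bot) (\<phi> top)\<close> and \<open>sup (\<phi> bot) (\<phi> top)\<close>. This holds even for all values of \<open>f\<close>:
  every tuple of bounds arises from the least one by changing components from \<open>bot\<close> to \<open>top\<close>,
  and the decomposition controls what each such change does to \<open>f\<close> by means of \<open>\<phi> top\<close> alone.
\<close>

section \<open>Medians in distributive lattices\<close>

lemma med_eq_truncation:
  fixes a b t :: "'a::distrib_lattice"
  shows "med a t b = sup (inf a b) (inf t (sup a b))"
  by (simp add: med_def inf_sup_distrib1 ac_simps)

lemma med_eq_middle_iff:
  fixes a b t :: "'a::distrib_lattice"
  shows "t = med a t b \<longleftrightarrow> inf a b \<le> t \<and> t \<le> sup a b"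
proof
  assume "t = med a t b"
  moreover have "inf a b \<le> med a t b"
    unfolding med_eq_truncation by simp
  moreover have "med a t b \<le> sup a b"
    unfolding med_eq_truncation by (simp add: le_infI1 le_supI1)
  ultimately show "inf a b \<le> t \<and> t \<le> sup a b"
    by simp
qed (simp add: med_eq_truncation inf_absorb1 sup_absorb2)

lemma inf_le_med: "inf a b \<le> med a t b"
  for a b t :: "'a::lattice"
  by (simp add: med_def inf_commute)

lemma med_le: "a \<le> u \<Longrightarrow> b \<le> u \<Longrightarrow> med a t b \<le> u"
  for a b t u :: "'a::lattice"
  by (simp add: med_def le_infI1 le_infI2)

text \<open>
  Truncating to the interval from \<open>c\<close> to \<open>d\<close> turns \<open>sup e (inf t g)\<close> into \<open>sup c (inf t d)\<close>, and
  the two outer arguments of the median have already been truncated to that interval.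
\<close>

lemma med_truncated_bounds:
  fixes a b c d e g t :: "'a::distrib_lattice"
  assumes "t = med a t b" and "e \<le> c" "c \<le> d" "d \<le> g"
  shows "med (sup c (inf a d)) (sup e (inf t g)) (sup c (inf b d)) = sup c (inf t d)"
proof -
  let ?l = "sup c (inf (inf a b) d)" and ?u = "sup c (inf (sup a b) d)"
  have t: "inf a b \<le> t" "t \<le> sup a b"
    using assms(1) by (simp_all only: med_eq_middle_iff)
  have l: "inf (sup c (inf a d)) (sup c (inf b d)) = ?l"
    by (simp add: sup_inf_distrib1 ac_simps)
  have u: "sup (sup c (inf a d)) (sup c (inf b d)) = ?u"
    by (simp only: inf_sup_distrib2 sup_assoc sup_left_commute sup_commute sup_left_idem)
  have "?u \<le> d"
    using assms(3) by simp
  have "sup c (inf (sup e (inf t g)) d) = sup c (inf t d)"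
    using assms(2,4) by (intro order.antisym)
      (auto simp: inf_sup_distrib2 inf_assoc inf_absorb2 intro: le_infI1 le_supI1 le_supI2)
  moreover have "inf (sup e (inf t g)) ?u = inf (inf (sup e (inf t g)) d) ?u"
    using \<open>?u \<le> d\<close> by (simp only: inf_assoc inf_absorb2)
  ultimately have "sup c (inf (sup e (inf t g)) ?u) = inf (sup c (inf t d)) ?u"
    by (simp only: sup_inf_distrib1[of c _ ?u] sup_left_idem)
  also have "\<dots> = sup c (inf t d)"
    using t by (intro inf_absorb1 sup_mono inf_mono order.refl)
  finally have upper: "sup c (inf (sup e (inf t g)) ?u) = sup c (inf t d)" .
  have "med (sup c (inf a d)) (sup e (inf t g)) (sup c (inf b d))
      = sup (sup c (inf (inf a b) d)) (inf (sup e (inf t g)) ?u)"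
    by (simp only: med_eq_truncation l u)
  also have "\<dots> = sup (inf (inf a b) d) (sup c (inf t d))"
    by (metis upper sup.assoc sup.commute)
  also have "\<dots> = sup c (inf t d)"
    using t by (intro sup_absorb2 le_supI2 inf_mono order.refl)
  finally show ?thesis .
qed

section \<open>Quasi-polynomial functions are quasi-median decomposable\<close>

lemma lattice_polynomial_mono:
  assumes "lattice_polynomial p" and "\<And>i. y i \<le> z i"
  shows "p y \<le> p z"
  using assms(1)
proof induction
  case (inf p q)
  from inf.IH show ?case by (rule inf_mono)
next
  case (sup p q)
  from sup.IH show ?case by (rule sup_mono)
qed (simp_all add: assms(2))

lemma inf_of_truncations:
  fixes c d c' d' s :: "'a::distrib_lattice"
  assumes "c \<le> d" "c' \<le> d'"
  shows "inf (sup c (inf s d)) (sup c' (inf s d')) = sup (inf c c') (inf s (inf d d'))"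
proof -
  have cross: "inf c (inf s d') \<le> inf s (inf d d')" "inf (inf s d) c' \<le> inf s (inf d d')"
    using assms by (auto intro: le_infI1 le_infI2)
  have "inf (sup c (inf s d)) (sup c' (inf s d'))
      = sup (inf c c') (sup (inf c (inf s d')) (sup (inf (inf s d) c') (inf (inf s d) (inf s d'))))"
    by (simp only: inf_sup_distrib1 inf_sup_distrib2 sup_assoc sup_left_commute sup_commute)
  also have "inf (inf s d) (inf s d') = inf s (inf d d')"
    by (simp add: ac_simps)
  finally show ?thesis
    by (simp only: cross sup_absorb2)
qed

text \<open>
  The set \<open>K\<close> of components that vary together is arbitrary so that a single component and the
  diagonal are both covered. Monotonicity is what makes the \<open>inf\<close> of two such expressions
  collapse to one of the same form.
\<close>

lemma lattice_polynomial_on_line: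
  fixes p :: "('n \<Rightarrow> 'a::{distrib_lattice, bounded_lattice}) \<Rightarrow> 'a"
  assumes "lattice_polynomial p"
  shows "p (override_on y (\<lambda>_. s) K)
      = sup (p (override_on y (\<lambda>_. bot) K)) (inf s (p (override_on y (\<lambda>_. top) K)))"
  using assms
proof induction
  case (proj i)
  then show ?case by (simp add: override_on_def inf.absorb2 sup.absorb1)
next
  case (const c)
  then show ?case by (simp add: sup.absorb1)
next
  case (inf p q)
  let ?p = "\<lambda>s. p (override_on y (\<lambda>_. s) K)" and ?q = "\<lambda>s. q (override_on y (\<lambda>_. s) K)"
  have "?p bot \<le> ?p top" "?q bot \<le> ?q top"
    by (rule lattice_polynomial_mono[OF inf.hyps(1)] lattice_polynomial_mono[OF inf.hyps(2)],
        simp add: override_on_def)+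
  then have "inf (sup (?p bot) (inf s (?p top))) (sup (?q bot) (inf s (?q top)))
      = sup (inf (?p bot) (?q bot)) (inf s (inf (?p top) (?q top)))"
    by (rule inf_of_truncations)
  then show ?case
    by (simp only: inf.IH[symmetric])
next
  case (sup p q)
  let ?p = "\<lambda>s. p (override_on y (\<lambda>_. s) K)" and ?q = "\<lambda>s. q (override_on y (\<lambda>_. s) K)"
  have "sup (sup (?p bot) (inf s (?p top))) (sup (?q bot) (inf s (?q top)))
      = sup (sup (?p bot) (?q bot)) (inf s (sup (?p top) (?q top)))"
    by (simp add: inf_sup_distrib1 ac_simps)
  then show ?case
    by (simp only: sup.IH[symmetric])
qed

lemma quasi_polynomial_imp_quasi_median_decomposable:
  fixes f :: "('n \<Rightarrow> 'x::bounded_lattice) \<Rightarrow> 'y::{distrib_lattice, bounded_lattice}"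
  assumes "quasi_polynomial f"
  shows "quasi_median_decomposable f"
  unfolding quasi_median_decomposable_def
proof (intro allI)
  fix x :: "'n \<Rightarrow> 'x" and k
  from assms obtain p :: "('n \<Rightarrow> 'y) \<Rightarrow> 'y" and \<phi> where p: "lattice_polynomial p"
    and \<phi>: "\<And>x. \<phi> x = med (\<phi> bot) (\<phi> x) (\<phi> top)"
    and f: "\<And>x. f x = p (\<lambda>i. \<phi> (x i))"
    unfolding quasi_polynomial_def by auto
  let ?y = "\<lambda>i. \<phi> (x i)"
  let ?c = "p (?y(k := bot))" and ?d = "p (?y(k := top))"
  have line: "f (x(k := z)) = sup ?c (inf (\<phi> z) ?d)" for z
  proof -
    have "(\<lambda>i. \<phi> ((x(k := z)) i)) = ?y(k := \<phi> z)"
      by auto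
    then show ?thesis
      using lattice_polynomial_on_line[OF p, of ?y "\<phi> z" "{k}"]
      by (simp add: f override_on_insert)
  qed
  have diagonal: "diagonal_section f z
      = sup (p (\<lambda>_. bot)) (inf (\<phi> z) (p (\<lambda>_. top)))" for z
    using lattice_polynomial_on_line[OF p, of ?y "\<phi> z" UNIV]
    by (simp add: diagonal_section_def f override_on_def)
  have "p (\<lambda>_. bot) \<le> ?c" "?c \<le> ?d" "?d \<le> p (\<lambda>_. top)"
    by (rule lattice_polynomial_mono[OF p], simp)+
  from med_truncated_bounds[OF \<phi> this]
  have "med (f (x(k := bot))) (diagonal_section f (x k)) (f (x(k := top))) = f (x(k := x k))"
    by (simp only: line diagonal)
  then show "f x = med (f (x(k := bot))) (diagonal_section f (x k)) (f (x(k := top)))"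
    by simp
qed

section \<open>Quasi-median decomposable functions are quasi-polynomial\<close>

lemma quasi_median_decomposableD:
  assumes "quasi_median_decomposable f"
  shows "f x = med (f (x(k := bot))) (diagonal_section f (x k)) (f (x(k := top)))"
  using assms unfolding quasi_median_decomposable_def by blast

lemma lattice_polynomial_med:
  assumes "lattice_polynomial p" "lattice_polynomial q" "lattice_polynomial r"
  shows "lattice_polynomial (\<lambda>y. med (p y) (q y) (r y))"
  unfolding med_def by (intro lattice_polynomial.intros assms)

text \<open>
  The components outside \<open>K\<close> are held fixed at \<open>z\<close>. Decomposing at a new component replaces it by the
  bounds, so the induction must range over all \<open>z\<close>.
\<close>

lemma quasi_median_decomposable_expansion:
  fixes f :: "('n \<Rightarrow> 'x::bounded_lattice) \<Rightarrow> 'y::lattice"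
  assumes f: "quasi_median_decomposable f" and "finite K"
  shows "\<exists>p :: ('n \<Rightarrow> 'y) \<Rightarrow> 'y. lattice_polynomial p \<and>
    (\<forall>x. f (override_on z x K) = p (\<lambda>i. diagonal_section f (x i)))"
  using assms(2)
proof (induction K arbitrary: z)
  case empty
  show ?case
    by (intro exI[of _ "\<lambda>_. f z"]) (simp add: lattice_polynomial.const)
next
  case (insert k K)
  obtain p q :: "('n \<Rightarrow> 'y) \<Rightarrow> 'y" where p: "lattice_polynomial p"
    "\<And>x. f (override_on (z(k := bot)) x K) = p (\<lambda>i. diagonal_section f (x i))"
    and q: "lattice_polynomial q"
    "\<And>x. f (override_on (z(k := top)) x K) = q (\<lambda>i. diagonal_section f (x i))"
    using insert.IH by metis
  have upd: "(override_on z x (insert k K))(k := a) = override_on (z(k := a)) x K" for x a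
    using insert.hyps by (auto simp: override_on_def)
  have "f (override_on z x (insert k K))
      = med (p (\<lambda>i. diagonal_section f (x i))) (diagonal_section f (x k))
          (q (\<lambda>i. diagonal_section f (x i)))" for x
    by (subst quasi_median_decomposableD[OF f, of _ k]) (simp add: upd p q)
  then show ?case
    using lattice_polynomial_med[OF p(1) lattice_polynomial.proj[of k] q(1)]
    by (intro exI[of _ "\<lambda>y. med (p y) (y k) (q y)"]) simp
qed

text \<open>
  Raising component \<open>k\<close> from \<open>bot\<close> to \<open>top\<close> changes the value \<open>v\<close> of \<open>f\<close> into some \<open>w\<close> satisfying
  \<open>w = med v (diagonal_section f top) w\<close>, which puts \<open>w\<close> between \<open>inf v (diagonal_section f top)\<close>
  and \<open>sup v (diagonal_section f top)\<close>.
\<close>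

lemma quasi_median_decomposable_between_at_bounds:
  fixes f :: "('n \<Rightarrow> 'x::bounded_lattice) \<Rightarrow> 'y::distrib_lattice"
  assumes f: "quasi_median_decomposable f" and "finite S"
  defines "l \<equiv> inf (diagonal_section f bot) (diagonal_section f top)"
    and "u \<equiv> sup (diagonal_section f bot) (diagonal_section f top)"
  shows "l \<le> f (override_on (\<lambda>_. bot) (\<lambda>_. top) S) \<and> f (override_on (\<lambda>_. bot) (\<lambda>_. top) S) \<le> u"
  using assms(2)
proof induction
  case empty
  show ?case by (simp add: l_def u_def diagonal_section_def)
next
  case (insert k S)
  let ?e = "override_on (\<lambda>_. bot) (\<lambda>_. top) :: 'n set \<Rightarrow> 'n \<Rightarrow> 'x"
  let ?m = "diagonal_section f top"
  have upd: "(?e (insert k S))(k := bot) = ?e S" "(?e (insert k S))(k := top) = ?e (insert k S)"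
    "?e (insert k S) k = top"
    using insert.hyps by (auto simp: override_on_def)
  have "f (?e (insert k S)) = med (f (?e S)) ?m (f (?e (insert k S)))"
    using quasi_median_decomposableD[OF f, of "?e (insert k S)" k] by (simp only: upd)
  then have "f (?e (insert k S)) = med (f (?e S)) (f (?e (insert k S))) ?m"
    by (simp add: med_def ac_simps)
  then have "inf (f (?e S)) ?m \<le> f (?e (insert k S))" "f (?e (insert k S)) \<le> sup (f (?e S)) ?m"
    by (simp_all only: med_eq_middle_iff)
  moreover have "l \<le> inf (f (?e S)) ?m" "sup (f (?e S)) ?m \<le> u"
    using insert.IH by (simp_all add: l_def u_def)
  ultimately show ?case
    by (meson order.trans)
qed

text \<open>
  Both bounds pass from \<open>f (x(k := bot))\<close> and \<open>f (x(k := top))\<close> to their median \<open>f x\<close>, so that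
  arbitrary components can be admitted one at a time.
\<close>

lemma quasi_median_decomposable_between:
  fixes f :: "('n::finite \<Rightarrow> 'x::bounded_lattice) \<Rightarrow> 'y::distrib_lattice"
  assumes f: "quasi_median_decomposable f"
  defines "l \<equiv> inf (diagonal_section f bot) (diagonal_section f top)"
    and "u \<equiv> sup (diagonal_section f bot) (diagonal_section f top)"
  shows "l \<le> f x \<and> f x \<le> u"
proof -
  have "l \<le> f x \<and> f x \<le> u" if "finite K" "\<And>i. i \<notin> K \<Longrightarrow> x i = bot \<or> x i = top" for K x
    using that
  proof (induction K arbitrary: x)
    case empty
    have "x i = override_on (\<lambda>_. bot) (\<lambda>_. top) {i. x i = top} i" for i
      using empty.prems[of i] by (auto simp: override_on_def)
    then have "x = override_on (\<lambda>_. bot) (\<lambda>_. top) {i. x i = top}"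
      by (rule ext)
    then show ?case
      using quasi_median_decomposable_between_at_bounds[OF f, of "{i. x i = top}"]
      by (simp add: l_def u_def)
  next
    case (insert k K)
    have "l \<le> f (x(k := bot)) \<and> f (x(k := bot)) \<le> u" "l \<le> f (x(k := top)) \<and> f (x(k := top)) \<le> u"
      by (rule insert.IH; use insert.prems in auto)+
    then show ?case
      by (subst (1 2) quasi_median_decomposableD[OF f, of x k])
        (meson inf_le_med le_inf_iff order.trans med_le)
  qed
  from this[of UNIV x] show ?thesis by simp
qed

lemma quasi_median_decomposable_imp_quasi_polynomial:
  fixes f :: "('n::finite \<Rightarrow> 'x::bounded_lattice) \<Rightarrow> 'y::distrib_lattice"
  assumes f: "quasi_median_decomposable f"
  shows "quasi_polynomial f"
proof -
  let ?\<phi> = "diagonal_section f"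
  obtain p :: "('n \<Rightarrow> 'y) \<Rightarrow> 'y" where "lattice_polynomial p" "\<And>x. f x = p (\<lambda>i. ?\<phi> (x i))"
    using quasi_median_decomposable_expansion[OF f, of UNIV "\<lambda>_. bot"]
    by (auto simp: override_on_def)
  moreover have "?\<phi> x = med (?\<phi> bot) (?\<phi> x) (?\<phi> top)" for x
    using quasi_median_decomposable_between[OF f, of "\<lambda>_. x"]
    unfolding med_eq_middle_iff by (simp add: diagonal_section_def)
  ultimately show ?thesis
    unfolding quasi_polynomial_def by blast
qed

section \<open>The characterisation\<close>

theorem theorem12:
  fixes f :: "('n::finite \<Rightarrow> 'x::{distrib_lattice, bounded_lattice})
                \<Rightarrow> 'y::{distrib_lattice, bounded_lattice}"
  shows "quasi_polynomial f \<longleftrightarrow> quasi_median_decomposable f"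
  using quasi_polynomial_imp_quasi_median_decomposable
    quasi_median_decomposable_imp_quasi_polynomial by blast

end
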